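(* Let $\mathbb{Y}$ be a set and let $\mathcal{F}(\mathbb{Y})\subset\mathbb{R}^{\mathbb{Y}}$ be a collection of functions, equipped with a metric $\widetilde d$ and the associated Borel $\sigma$-algebra $\mathcal{B}(\mathcal{F}(\mathbb{Y}))$. Assume that there exist a sequence $(y_n)_{n\ge1}$ in $\mathbb{Y}$ and a Borel measurable map $\rho\colon\mathbb{R}^{\mathbb{N}}\times\mathbb{R}^{\mathbb{N}}\to[0,\infty]$ such that, on defining $\Phi\colon\mathcal{F}(\mathbb{Y})\to\mathbb{R}^{\mathbb{N}}$ by $\Phi(f)=(f(y_n))_{n\ge1}$, we have $$\widetilde d(f,g)=\rho(\Phi(f),\Phi(g))\qquad\text{for all } f,g\in\mathcal{F}(\mathbb{Y}).$$ Let $(\mathbb{X},\mathcal{A})$ be a measurable space, and let $G\colon\mathbb{X}\times\mathbb{Y}\to\mathbb{R}$ be such that: (i) for every $y\in\mathbb{Y}$, the map $x\mapsto G(x,y)$ is $\mathcal{A}$-measurable; (ii) for every $x\in\mathbb{X}$, the function $G(x,\cdot)$ belongs to $\mathcal{F}(\mathbb{Y})$. Define $\widetilde G\colon\mathbb{X}\to\mathcal{F}(\mathbb{Y})$ by $\widetilde G(x)=G(x,\cdot)$. Then the preimage of every open ball in $\mathcal{F}(\mathbb{Y})$ under $\widetilde G$ is measurable in $\mathbb{X}$. If the range $\widetilde G(\mathbb{X})$ is separable under $\widetilde d$, then $\widetilde G$ is $\mathcal{A}/\mathcal{B}(\mathcal{F}(\mathbb{Y}))$-measurable and is strongly measurable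 with respect to every measure on $(\mathbb{X},\mathcal{A})$.
   Context: A function from a measurable space $(\mathbb{X},\mathcal{A})$ to a metric space is simple if it is measurable (for the Borel $\sigma$-algebra of the target) and takes only finitely many values. Given a measure $\mu$ on $(\mathbb{X},\mathcal{A})$, a function is strongly measurable with respect to $\mu$ if it is the $\mu$-almost everywhere pointwise limit of a sequence of simple functions. *)

theory Defs
  imports "HOL-Analysis.Analysis"
begin

text \<open>A metric space is given, as in \<^locale>\<open>Metric_space\<close>, by a carrier \<open>F\<close> and a distance \<open>d\<close>;
  \<open>metric_borel F d\<close> is the carrier with the sigma-algebra generated by its open sets.\<close>

definition metric_borel :: "'b set \<Rightarrow> ('b \<Rightarrow> 'b \<Rightarrow> real) \<Rightarrow> 'b measure" where
  "metric_borel F d = sigma F {U. openin (Metric_space.mtopology F d) U}"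

definition simple_map :: "'a measure \<Rightarrow> 'b set \<Rightarrow> ('b \<Rightarrow> 'b \<Rightarrow> real) \<Rightarrow> ('a \<Rightarrow> 'b) \<Rightarrow> bool" where
  "simple_map M F d s \<longleftrightarrow> s \<in> M \<rightarrow>\<^sub>M metric_borel F d \<and> finite (s ` space M)"

definition strongly_measurable :: "'a measure \<Rightarrow> 'b set \<Rightarrow> ('b \<Rightarrow> 'b \<Rightarrow> real) \<Rightarrow> ('a \<Rightarrow> 'b) \<Rightarrow> bool" where
  "strongly_measurable \<mu> F d f \<longleftrightarrow>
     f \<in> space \<mu> \<rightarrow> F \<and>
     (\<exists>s :: nat \<Rightarrow> 'a \<Rightarrow> 'b.
        (\<forall>n. simple_map \<mu> F d (s n)) \<and>
        (AE x in \<mu>. limitin (Metric_space.mtopology F d) (\<lambda>n. s n x) (f x) sequentially))"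

end

theory Submission
  imports Defs
begin

text \<open>The distance from \<open>Gt x\<close> to a fixed \<open>f \<in> F\<close> is \<open>\<rho>\<close> evaluated at \<open>(\<Phi> f, \<Phi> (Gt x))\<close>, and
  \<open>x \<mapsto> \<Phi> (Gt x)\<close> is a measurable map into the sequence space because each of its coordinates
  is some \<open>x \<mapsto> G (x, y n)\<close>. Preimages of balls are therefore measurable.

  The rest holds for any map \<open>f\<close> into a metric space that has separable range and measurable
  preimages of balls. Let \<open>s\<close> enumerate a countable dense subset of the range. Within the range,
  an open set coincides with a countable union of balls about points of \<open>s\<close>, whence \<open>f\<close> is Borel
  measurable (lemma \<open>measurable_metric_borel_if_balls\<close>). Sending \<open>x\<close> to a point among
  \<open>s 0, \<dots>, s n\<close> nearest to \<open>f x\<close> gives simple maps that converge to \<open>f\<close> at every point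
  (lemma \<open>strongly_measurable_if_balls\<close>).\<close>

text \<open>The least index in \<open>{0..n}\<close> at which \<open>a\<close> attains its minimum over \<open>{0..n}\<close>.\<close>

fun argmin_upto :: "(nat \<Rightarrow> real) \<Rightarrow> nat \<Rightarrow> nat" where
  "argmin_upto a 0 = 0"
| "argmin_upto a (Suc n) =
     (if a (Suc n) < a (argmin_upto a n) then Suc n else argmin_upto a n)"

lemma argmin_upto_le: "argmin_upto a n \<le> n"
  by (induction n) auto

lemma argmin_upto_minimal: "k \<le> n \<Longrightarrow> a (argmin_upto a n) \<le> a k"
  by (induction n) (force simp: le_Suc_eq)+

lemma measurable_argmin_upto:
  assumes [measurable]: "\<And>k. a k \<in> borel_measurable M"
  shows "(\<lambda>x. argmin_upto (\<lambda>k. a k x) n) \<in> M \<rightarrow>\<^sub>M count_space UNIV"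
proof (induction n)
  case (Suc n)
  note [measurable] = Suc
  have [measurable]: "(\<lambda>x. a (argmin_upto (\<lambda>k. a k x) n) x) \<in> borel_measurable M"
    by (rule measurable_compose_countable[OF _ Suc]) simp
  show ?case by simp
qed simp

lemma space_metric_borel:
  assumes "Metric_space F d"
  shows "space (metric_borel F d) = F"
proof -
  interpret Metric_space F d by fact
  show ?thesis
    unfolding metric_borel_def
    by (rule space_measure_of) (use openin_subset[of mtopology] in auto)
qed

lemma dense_sequence_if_separable:
  fixes F :: "'b set"
  assumes "Metric_space F d" and "A \<subseteq> F" and "A \<noteq> {}"
    and "separable_space (subtopology (Metric_space.mtopology F d) A)"
  shows "\<exists>s :: nat \<Rightarrow> 'b. range s \<subseteq> A \<and> (\<forall>a\<in>A. \<forall>e>0. \<exists>k. d (s k) a < e)"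
proof -
  interpret Metric_space F d by fact
  obtain C where C: "countable C" "C \<subseteq> A"
    and dense: "subtopology mtopology A closure_of C = A"
    using assms by (auto simp: separable_space_def Int_absorb1)
  have "C \<noteq> {}"
    using dense \<open>A \<noteq> {}\<close> by auto
  have near: "\<exists>c\<in>C. d c a < e" if "a \<in> A" "e > 0" for a e
  proof -
    have "a \<in> mtopology closure_of C"
      using dense that C by (auto simp: closure_of_subtopology Int_absorb1)
    then show ?thesis
      using that by (auto simp: metric_closure_of commute)
  qed
  show ?thesis
  proof (rule exI[of _ "from_nat_into C"], intro conjI ballI allI impI)
    show "range (from_nat_into C) \<subseteq> A"
      using range_from_nat_into_subset[OF \<open>C \<noteq> {}\<close>] C by blast
    show "\<exists>k. d (from_nat_into C k) a < e" if "a \<in> A" "e > 0" for a e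
      using near[OF that] from_nat_into_surj[OF \<open>countable C\<close>] by metis
  qed
qed

lemma measurable_metric_borel_if_balls:
  fixes F :: "'b set"
  assumes "Metric_space F d" and f: "f \<in> space M \<rightarrow> F"
    and balls: "\<And>c r. c \<in> F \<Longrightarrow> r > 0 \<Longrightarrow> f -` Metric_space.mball F d c r \<inter> space M \<in> sets M"
    and sep: "separable_space (subtopology (Metric_space.mtopology F d) (f ` space M))"
  shows "f \<in> M \<rightarrow>\<^sub>M metric_borel F d"
proof (cases "space M = {}")
  case True
  then show ?thesis by (simp add: measurable_def)
next
  case False
  interpret Metric_space F d by fact
  have fF: "f ` space M \<subseteq> F" and ne: "f ` space M \<noteq> {}" using f False by auto
  obtain s :: "nat \<Rightarrow> 'b" where s: "range s \<subseteq> f ` space M"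
    and dense: "\<forall>a\<in>f ` space M. \<forall>e>0. \<exists>k. d (s k) a < e"
    using dense_sequence_if_separable[OF assms(1) fF ne sep] by blast
  have sF: "s k \<in> F" for k using s fF by auto
  have "f -` U \<inter> space M \<in> sets M" if U: "openin mtopology U" for U
  proof -
    define I where "I = {(k, n). mball (s k) (1 / real (Suc n)) \<subseteq> U}"
    have "f -` U \<inter> space M = (\<Union>(k, n)\<in>I. f -` mball (s k) (1 / real (Suc n)) \<inter> space M)"
    proof (intro subset_antisym subsetI)
      fix x assume x: "x \<in> f -` U \<inter> space M"
      then have "f x \<in> F" using f by auto
      obtain r where r: "r > 0" "mball (f x) r \<subseteq> U"
        using U x by (auto simp: openin_mtopology)
      \<comment> \<open>Half the radius, so that the ball about the nearby \<open>s k\<close> stays inside \<open>U\<close>.\<close>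
      obtain n where n: "1 / real (Suc n) < r / 2"
        using nat_approx_posE[of "r / 2"] r by auto
      obtain k where k: "d (s k) (f x) < 1 / real (Suc n)"
        using dense x by (meson IntD2 imageI of_nat_0_less_iff zero_less_Suc zero_less_divide_1_iff)
      have "mball (s k) (1 / real (Suc n)) \<subseteq> mball (f x) r"
      proof
        fix z assume z: "z \<in> mball (s k) (1 / real (Suc n))"
        then have "d (f x) z \<le> d (s k) (f x) + d (s k) z"
          using triangle[of "f x" "s k" z] sF \<open>f x \<in> F\<close> by (simp add: commute)
        then show "z \<in> mball (f x) r"
          using z k n \<open>f x \<in> F\<close> by (auto simp: in_mball)
      qed
      then have "(k, n) \<in> I" using r by (auto simp: I_def)
      moreover have "x \<in> f -` mball (s k) (1 / real (Suc n)) \<inter> space M"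
        using x k sF \<open>f x \<in> F\<close> by (simp add: in_mball)
      ultimately show "x \<in> (\<Union>(k, n)\<in>I. f -` mball (s k) (1 / real (Suc n)) \<inter> space M)"
        by blast
    qed (auto simp: I_def)
    also have "\<dots> \<in> sets M"
      by (rule sets.countable_UN'') (auto intro!: balls sF)
    finally show ?thesis .
  qed
  then show ?thesis
    unfolding metric_borel_def
    by (intro measurable_measure_of) (use openin_subset[of mtopology] f in auto)
qed

lemma strongly_measurable_if_balls:
  fixes F :: "'b set"
  assumes "Metric_space F d" and f: "f \<in> space M \<rightarrow> F"
    and balls: "\<And>c r. c \<in> F \<Longrightarrow> r > 0 \<Longrightarrow> f -` Metric_space.mball F d c r \<inter> space M \<in> sets M"
    and sep: "separable_space (subtopology (Metric_space.mtopology F d) (f ` space M))"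
  shows "strongly_measurable M F d f"
proof (cases "space M = {}")
  case True
  then have "simple_map M F d f"
    by (simp add: simple_map_def measurable_def)
  moreover have "AE x in M. P x" for P
    by (rule AE_I2) (simp add: True)
  ultimately show ?thesis
    using f by (auto simp: strongly_measurable_def intro!: exI[of _ "\<lambda>_. f"])
next
  case False
  interpret Metric_space F d by fact
  have fF: "f ` space M \<subseteq> F" and ne: "f ` space M \<noteq> {}" using f False by auto
  obtain s :: "nat \<Rightarrow> 'b" where s: "range s \<subseteq> f ` space M"
    and dense: "\<forall>a\<in>f ` space M. \<forall>e>0. \<exists>k. d (s k) a < e"
    using dense_sequence_if_separable[OF assms(1) fF ne sep] by blast
  have sF: "s k \<in> F" for k using s fF by auto
  have dist_meas: "(\<lambda>x. d (s k) (f x)) \<in> borel_measurable M" for k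
  proof (rule borel_measurableI_less)
    fix r :: real
    have "{x \<in> space M. d (s k) (f x) < r} = f -` mball (s k) r \<inter> space M"
      using sF f by (auto simp: in_mball)
    also have "\<dots> \<in> sets M"
      using balls[OF sF] mball_eq_empty[of "s k" r] by (cases "r > 0") auto
    finally show "{x \<in> space M. d (s k) (f x) < r} \<in> sets M" .
  qed
  define i where "i n x = argmin_upto (\<lambda>k. d (s k) (f x)) n" for n x
  have "simple_map M F d (\<lambda>x. s (i n x))" for n
    unfolding simple_map_def
  proof
    have "s \<in> count_space UNIV \<rightarrow>\<^sub>M metric_borel F d"
      using sF by (simp add: space_metric_borel assms(1))
    then show "(\<lambda>x. s (i n x)) \<in> M \<rightarrow>\<^sub>M metric_borel F d"
      unfolding i_def by (rule measurable_compose[OF measurable_argmin_upto[OF dist_meas]])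
    have "(\<lambda>x. s (i n x)) ` space M \<subseteq> s ` {..n}"
      using argmin_upto_le by (auto simp: i_def)
    then show "finite ((\<lambda>x. s (i n x)) ` space M)"
      by (rule finite_subset) simp
  qed
  moreover have "limitin mtopology (\<lambda>n. s (i n x)) (f x) sequentially" if x: "x \<in> space M" for x
  proof -
    have "\<exists>N. \<forall>n\<ge>N. s (i n x) \<in> F \<and> d (s (i n x)) (f x) < e" if "e > 0" for e
    proof -
      obtain k where "d (s k) (f x) < e" using dense \<open>e > 0\<close> x by blast
      then have "d (s (i n x)) (f x) < e" if "n \<ge> k" for n
        using argmin_upto_minimal[OF that, of "\<lambda>k. d (s k) (f x)"] by (simp add: i_def)
      then show ?thesis using sF by blast
    qed
    then show ?thesis
      using x f by (auto simp: limit_metric_sequentially)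
  qed
  ultimately show ?thesis
    unfolding strongly_measurable_def using f
    by (intro conjI exI[of _ "\<lambda>n x. s (i n x)"] allI AE_I2)
qed

theorem theorem3p9:
  fixes Y :: "'y set"
    and F :: "('y \<Rightarrow> real) set"
    and d :: "('y \<Rightarrow> real) \<Rightarrow> ('y \<Rightarrow> real) \<Rightarrow> real"
    and y :: "nat \<Rightarrow> 'y"
    and \<rho> :: "(nat \<Rightarrow> real) \<times> (nat \<Rightarrow> real) \<Rightarrow> ennreal"
    and \<Phi> :: "('y \<Rightarrow> real) \<Rightarrow> nat \<Rightarrow> real"
    and M :: "'x measure"
    and G :: "'x \<times> 'y \<Rightarrow> real"
    and Gt :: "'x \<Rightarrow> 'y \<Rightarrow> real"
  assumes "F \<subseteq> Y \<rightarrow>\<^sub>E UNIV"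
    and "Metric_space F d"
    and "\<And>n. y n \<in> Y"
    and "\<rho> \<in> borel_measurable borel"
    and "\<Phi> = (\<lambda>f n. f (y n))"
    and "\<And>f g. f \<in> F \<Longrightarrow> g \<in> F \<Longrightarrow> ennreal (d f g) = \<rho> (\<Phi> f, \<Phi> g)"
    and "\<And>z. z \<in> Y \<Longrightarrow> (\<lambda>x. G (x, z)) \<in> borel_measurable M"
    and "Gt = (\<lambda>x. \<lambda>z\<in>Y. G (x, z))"
    and "\<And>x. x \<in> space M \<Longrightarrow> Gt x \<in> F"
  shows "(\<forall>f\<in>F. \<forall>r>0. Gt -` Metric_space.mball F d f r \<inter> space M \<in> sets M) \<and>
    (separable_space (subtopology (Metric_space.mtopology F d) (Gt ` space M)) \<longrightarrow>
       Gt \<in> M \<rightarrow>\<^sub>M metric_borel F d \<and>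
       (\<forall>\<mu>. sets \<mu> = sets M \<longrightarrow> strongly_measurable \<mu> F d Gt))"
proof -
  interpret Metric_space F d by fact
  have Gt_in: "Gt \<in> space M \<rightarrow> F" using assms(9) by auto
  have "(\<lambda>x. Gt x (y n)) \<in> borel_measurable M" for n
    using assms(3,7) by (simp add: assms(8))
  then have [measurable]: "(\<lambda>x. \<Phi> (Gt x)) \<in> borel_measurable M"
    unfolding assms(5) by (rule measurable_coordinatewise_then_product)
  note [measurable] = assms(4)
  have balls: "Gt -` mball f r \<inter> space M \<in> sets M" if "f \<in> F" "r > 0" for f r
  proof -
    have "Gt -` mball f r \<inter> space M = {x \<in> space M. \<rho> (\<Phi> f, \<Phi> (Gt x)) < ennreal r}"
      using that assms(9) by (auto simp: in_mball assms(6)[symmetric] ennreal_less_iff)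
    also have "\<dots> \<in> sets M" by measurable
    finally show ?thesis .
  qed
  have "strongly_measurable \<mu> F d Gt"
    if "separable_space (subtopology mtopology (Gt ` space M))" "sets \<mu> = sets M" for \<mu>
    using strongly_measurable_if_balls[of F d Gt \<mu>] balls that Gt_in assms(2)
      sets_eq_imp_space_eq[OF that(2)] by auto
  then show ?thesis
    using balls measurable_metric_borel_if_balls[OF assms(2) Gt_in balls] by blast
qed

end
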